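(* Let $\Gamma_1$ and $\Gamma_2$ be trees, and let $\Gamma$ be the tree obtained by gluing $\Gamma_1$ and $\Gamma_2$ as follows: take the disjoint union of $\Gamma_1$ and $\Gamma_2$, add one new vertex $\beta$, and join $\beta$ by an edge to one vertex of $\Gamma_1$ and by an edge to one vertex of $\Gamma_2$. If $\lambda$ is an eigenvalue of the Coxeter transformation of $\Gamma_1$ and an eigenvalue of the Coxeter transformation of $\Gamma_2$, then $\lambda$ is also an eigenvalue of the Coxeter transformation of $\Gamma$.
   Context: The Coxeter transformation of a tree with Cartan matrix $K$ is the product of all simple reflections $\sigma_v(z)=z-(Kz)_v\alpha_v$, each taken once, in some order; for a tree all such products are conjugate, so the eigenvalues do not depend on the order. The two new edges are ordinary (unweighted) edges. *)

theory Defs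
  imports "HOL-Analysis.Analysis"
begin

text \<open>
  A weighted tree is encoded by its Cartan matrix, the vertices being the elements of a
  finite type: two distinct vertices are joined by an edge iff the corresponding matrix entry is
  nonzero. An ordinary (unweighted) edge has the entry \<open>-1\<close> in both directions.
\<close>

definition cartan_matrix :: "int ^ 'a ^ 'a \<Rightarrow> bool" where
  "cartan_matrix K \<longleftrightarrow>
     (\<forall>v. K $ v $ v = 2) \<and>
     (\<forall>v w. v \<noteq> w \<longrightarrow> K $ v $ w \<le> 0) \<and>
     (\<forall>v w. K $ v $ w = 0 \<longleftrightarrow> K $ w $ v = 0)"

definition edge :: "int ^ 'a ^ 'a \<Rightarrow> 'a \<Rightarrow> 'a \<Rightarrow> bool" where
  "edge K v w \<longleftrightarrow> v \<noteq> w \<and> K $ v $ w \<noteq> 0"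

definition graph_cycle :: "('a \<Rightarrow> 'a \<Rightarrow> bool) \<Rightarrow> 'a list \<Rightarrow> bool" where
  "graph_cycle E xs \<longleftrightarrow>
     3 \<le> length xs \<and> distinct xs \<and> successively E xs \<and> E (last xs) (hd xs)"

definition cartan_tree :: "int ^ 'a ^ 'a \<Rightarrow> bool" where
  "cartan_tree K \<longleftrightarrow>
     cartan_matrix K \<and>
     (\<forall>v w. (edge K)\<^sup>*\<^sup>* v w) \<and>
     (\<nexists>xs. graph_cycle (edge K) xs)"

definition simple_reflection ::
    "int ^ 'a ^ 'a \<Rightarrow> 'a \<Rightarrow> complex ^ 'a \<Rightarrow> complex ^ 'a" where
  "simple_reflection K v z = z - ((map_matrix of_int K *v z) $ v) *s axis v 1"

text \<open>
  One Coxeter transformation for each order of the vertices; for a tree they are all conjugate.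
\<close>

definition coxeter_transformations ::
    "int ^ 'a ^ 'a \<Rightarrow> (complex ^ 'a \<Rightarrow> complex ^ 'a) set" where
  "coxeter_transformations K =
     {foldr (\<lambda>v f. simple_reflection K v \<circ> f) vs id | vs. distinct vs \<and> set vs = UNIV}"

definition eigenvalue_of :: "(complex ^ 'a \<Rightarrow> complex ^ 'a) \<Rightarrow> complex \<Rightarrow> bool" where
  "eigenvalue_of f \<mu> \<longleftrightarrow> (\<exists>z. z \<noteq> 0 \<and> f z = \<mu> *s z)"

text \<open>
  The glued tree lives on the type \<open>('a + 'b) option\<close>: \<open>None\<close> is the new vertex, and it is
  joined to the vertex \<open>p\<close> of the first tree and to the vertex \<open>q\<close> of the second.
\<close>

fun glue_entry ::
    "int ^ 'a ^ 'a \<Rightarrow> 'a \<Rightarrow> int ^ 'b ^ 'b \<Rightarrow> 'b \<Rightarrow>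
     ('a + 'b) option \<Rightarrow> ('a + 'b) option \<Rightarrow> int" where
  "glue_entry K1 p K2 q (Some (Inl v)) (Some (Inl w)) = K1 $ v $ w"
| "glue_entry K1 p K2 q (Some (Inr v)) (Some (Inr w)) = K2 $ v $ w"
| "glue_entry K1 p K2 q (Some (Inl v)) (Some (Inr w)) = 0"
| "glue_entry K1 p K2 q (Some (Inr v)) (Some (Inl w)) = 0"
| "glue_entry K1 p K2 q None None = 2"
| "glue_entry K1 p K2 q None (Some (Inl w)) = (if w = p then -1 else 0)"
| "glue_entry K1 p K2 q (Some (Inl v)) None = (if v = p then -1 else 0)"
| "glue_entry K1 p K2 q None (Some (Inr w)) = (if w = q then -1 else 0)"
| "glue_entry K1 p K2 q (Some (Inr v)) None = (if v = q then -1 else 0)"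

definition glue ::
    "int ^ 'a ^ 'a \<Rightarrow> 'a \<Rightarrow> int ^ 'b ^ 'b \<Rightarrow> 'b \<Rightarrow>
     int ^ ('a + 'b) option ^ ('a + 'b) option" where
  "glue K1 p K2 q = (\<chi> i j. glue_entry K1 p K2 q i j)"

end

theory Submission
  imports Defs
begin

text \<open>
  Reflecting one vertex at a time, \<open>C z = \<mu> z\<close> becomes a linear system with one equation for each
  vertex \<open>v\<close>, in which the neighbour \<open>w\<close> contributes \<open>\<mu> K\<^sub>v\<^sub>w z\<^sub>w\<close> or \<open>K\<^sub>v\<^sub>w z\<^sub>w\<close> according to
  whether \<open>w\<close> is reflected before or after \<open>v\<close> (\<open>eigenvector_iff_weighted_kernel\<close>). So \<open>\<mu>\<close> is an
  eigenvalue iff a certain entrywise weighting of \<open>K\<close> is singular. The weighting depends on the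
  order of the reflections, but the product of the two weights on an edge is always \<open>\<mu>\<close>. Since
  \<open>\<mu> \<noteq> 0\<close>, two orders therefore differ by a multiplicative 1-cocycle on the edges. On a graph
  without cycles every such cocycle is a coboundary (\<open>acyclic_cocycle_trivial\<close>), so rescaling the
  coordinates carries solutions for one order to solutions for the other
  (\<open>weighted_kernel_transfer\<close>).

  Fix an order on the glued tree and take nonzero solutions \<open>x\<close> and \<open>y\<close> on the two parts for the
  weights induced by it. A vector \<open>(a x, 0, b y)\<close> with the value \<open>0\<close> at the new vertex satisfies
  all equations at the old vertices, because the new vertex contributes nothing to them. What
  remains is the equation at the new vertex: one homogeneous linear condition on the two scalars
  \<open>a\<close> and \<open>b\<close>, which has a nonzero solution.
\<close>

section \<open>Products of reflections as linear systems\<close>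

primrec reflection_product ::
    "int ^ 'a ^ 'a \<Rightarrow> 'a::finite list \<Rightarrow> complex ^ 'a \<Rightarrow> complex ^ 'a" where
  "reflection_product K [] z = z"
| "reflection_product K (v # vs) z = simple_reflection K v (reflection_product K vs z)"

lemma coxeter_transformations_eq:
  "coxeter_transformations K = {reflection_product K vs | vs. distinct vs \<and> set vs = UNIV}"
proof -
  have "foldr (\<lambda>v f. simple_reflection K v \<circ> f) vs id = reflection_product K vs" for vs
    by (induction vs) (auto simp: fun_eq_iff)
  then show ?thesis
    by (simp add: coxeter_transformations_def)
qed

text \<open>The rightmost factor of a composition acts first, hence the position to the right of \<open>v\<close>.\<close>

definition acts_before :: "'a list \<Rightarrow> 'a \<Rightarrow> 'a \<Rightarrow> bool" where
  "acts_before vs w v \<longleftrightarrow> (\<exists>as bs. vs = as @ v # bs \<and> w \<in> set bs)"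

text \<open>
  The diagonal value makes the diagonal entry \<open>2\<close> of the Cartan matrix contribute \<open>\<mu> + 1\<close>, so that
  the eigenvalue equation is a plain kernel condition. If \<open>K = L + U\<close> with triangular \<open>L\<close>, \<open>U\<close>
  having unit diagonals, the weighted matrix is \<open>\<mu> L + U\<close>.
\<close>

definition coxeter_weight :: "'a list \<Rightarrow> complex \<Rightarrow> 'a \<Rightarrow> 'a \<Rightarrow> complex" where
  "coxeter_weight vs \<mu> v w =
     (if v = w then (\<mu> + 1) / 2 else if acts_before vs w v then \<mu> else 1)"

definition weighted_kernel ::
    "int ^ 'a ^ 'a \<Rightarrow> ('a \<Rightarrow> 'a \<Rightarrow> complex) \<Rightarrow> (complex ^ 'a::finite) set" where
  "weighted_kernel K c = {x. \<forall>v. (\<Sum>w\<in>UNIV. c v w * of_int (K $ v $ w) * x $ w) = 0}"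

lemma acts_before_iff:
  assumes "distinct (as @ v # bs)"
  shows "acts_before (as @ v # bs) w v \<longleftrightarrow> w \<in> set bs"
  using assms by (auto simp: acts_before_def append_eq_append_conv2 append_eq_Cons_conv Cons_eq_append_conv)

lemma coxeter_weight_mult_swap:
  assumes "distinct vs" "set vs = UNIV" "v \<noteq> w"
  shows "coxeter_weight vs \<mu> v w * coxeter_weight vs \<mu> w v = \<mu>"
proof -
  obtain as bs where vs: "vs = as @ v # bs"
    using assms(2) by (metis UNIV_I split_list)
  obtain cs ds where vs': "vs = cs @ w # ds"
    using assms(2) by (metis UNIV_I split_list)
  have "w \<in> set bs \<longleftrightarrow> v \<notin> set ds"
    using assms(1,3) vs vs'
    by (auto simp: append_eq_append_conv2 append_eq_Cons_conv Cons_eq_append_conv)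
  moreover have "acts_before vs w v \<longleftrightarrow> w \<in> set bs" "acts_before vs v w \<longleftrightarrow> v \<in> set ds"
    using acts_before_iff vs vs' assms(1) by metis+
  ultimately show ?thesis
    using assms(3) by (auto simp: coxeter_weight_def)
qed

lemma simple_reflection_nth:
  "simple_reflection K v z $ u =
     (if u = v then z $ v - (\<Sum>w\<in>UNIV. of_int (K $ v $ w) * z $ w) else z $ u)"
  by (simp add: simple_reflection_def matrix_vector_mult_def axis_def map_matrix_def)

lemma reflection_product_append:
  "reflection_product K (us @ vs) z = reflection_product K us (reflection_product K vs z)"
  by (induction us) auto

lemma reflection_product_nth_other:
  "u \<notin> set vs \<Longrightarrow> reflection_product K vs z $ u = z $ u"
  by (induction vs) (auto simp: simple_reflection_nth)

text \<open>
  Each coordinate is updated exactly once. When \<open>v\<close> is reflected, the coordinates to the right of it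
  in the list already have their final values and all others still have their initial values.
\<close>

lemma reflection_product_eq_iff:
  assumes "distinct vs" "set vs = UNIV"
  shows "reflection_product K vs x = y \<longleftrightarrow>
    (\<forall>as v bs. vs = as @ v # bs \<longrightarrow>
       y $ v = x $ v - (\<Sum>w\<in>UNIV. of_int (K $ v $ w) * (if w \<in> set bs then y $ w else x $ w)))"
    (is "?L \<longleftrightarrow> ?R")
proof
  assume L: ?L
  show ?R
  proof (intro allI impI)
    fix as v bs assume vs: "vs = as @ v # bs"
    let ?z = "reflection_product K bs x"
    have y: "y = reflection_product K as (simple_reflection K v ?z)"
      using L vs reflection_product_append[of K as "v # bs" x] by simp
    have z: "?z $ w = (if w \<in> set bs then y $ w else x $ w)" for w
    proof (cases "w \<in> set bs")
      case True
      then have "w \<notin> set as" "w \<noteq> v"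
        using assms(1) vs by auto
      then show ?thesis
        using True unfolding y by (simp add: reflection_product_nth_other simple_reflection_nth)
    qed (simp add: reflection_product_nth_other)
    have "y $ v = ?z $ v - (\<Sum>w\<in>UNIV. of_int (K $ v $ w) * ?z $ w)"
      using assms(1) unfolding y vs
      by (simp add: reflection_product_nth_other simple_reflection_nth)
    moreover have "?z $ v = x $ v"
      using assms(1) vs by (intro reflection_product_nth_other) auto
    ultimately show "y $ v = x $ v -
        (\<Sum>w\<in>UNIV. of_int (K $ v $ w) * (if w \<in> set bs then y $ w else x $ w))"
      by (simp add: z)
  qed
next
  assume R: ?R
  have "u \<in> set bs \<Longrightarrow> vs = as @ bs \<Longrightarrow> reflection_product K bs x $ u = y $ u" for u as bs
  proof (induction bs arbitrary: as u)
    case Nil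
    then show ?case by simp
  next
    case (Cons v bs)
    have z: "reflection_product K bs x $ w = (if w \<in> set bs then y $ w else x $ w)" for w
      using Cons.IH[of w "as @ [v]"] Cons.prems by (simp add: reflection_product_nth_other)
    have "v \<notin> set bs"
      using assms(1) Cons.prems by simp
    then show ?case
      using R[rule_format, OF Cons.prems(2)] Cons.prems(1)
      by (auto simp: simple_reflection_nth z)
  qed
  from this[of _ vs "[]"] show ?L
    using assms(2) by (auto simp: vec_eq_iff)
qed

lemma eigenvector_iff_weighted_kernel:
  assumes "distinct vs" "set vs = UNIV" and diag: "\<And>v. K $ v $ v = 2"
  shows "reflection_product K vs x = \<mu> *s x \<longleftrightarrow> x \<in> weighted_kernel K (coxeter_weight vs \<mu>)"
proof -
  have eq: "(\<mu> *s x) $ v = x $ v - (\<Sum>w\<in>UNIV. of_int (K $ v $ w) *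
          (if w \<in> set bs then (\<mu> *s x) $ w else x $ w)) \<longleftrightarrow>
        (\<Sum>w\<in>UNIV. coxeter_weight vs \<mu> v w * of_int (K $ v $ w) * x $ w) = 0"
    if vs: "vs = as @ v # bs" for as v bs
  proof -
    have v: "v \<notin> set bs" and before: "acts_before vs w v \<longleftrightarrow> w \<in> set bs" for w
      using acts_before_iff[of as v bs] assms(1) unfolding vs by auto
    have "(\<Sum>w\<in>UNIV. of_int (K $ v $ w) * (if w \<in> set bs then (\<mu> *s x) $ w else x $ w))
        = 2 * x $ v +
          (\<Sum>w\<in>UNIV-{v}. of_int (K $ v $ w) * (if w \<in> set bs then (\<mu> *s x) $ w else x $ w))"
      using v diag by (subst sum.remove[of UNIV v]) auto
    also have "(\<Sum>w\<in>UNIV-{v}. of_int (K $ v $ w) * (if w \<in> set bs then (\<mu> *s x) $ w else x $ w))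
        = (\<Sum>w\<in>UNIV-{v}. coxeter_weight vs \<mu> v w * of_int (K $ v $ w) * x $ w)"
      by (rule sum.cong) (auto simp: coxeter_weight_def before)
    also have "\<dots> = (\<Sum>w\<in>UNIV. coxeter_weight vs \<mu> v w * of_int (K $ v $ w) * x $ w)
        - (\<mu> + 1) * x $ v"
      using diag by (subst sum.remove[of UNIV v]) (auto simp: coxeter_weight_def)
    finally show ?thesis
      by (simp add: algebra_simps)
  qed
  have "reflection_product K vs x = \<mu> *s x \<longleftrightarrow> (\<forall>as v bs. vs = as @ v # bs \<longrightarrow>
      (\<Sum>w\<in>UNIV. coxeter_weight vs \<mu> v w * of_int (K $ v $ w) * x $ w) = 0)"
    unfolding reflection_product_eq_iff[OF assms(1,2)] using eq by blast
  also have "\<dots> \<longleftrightarrow> x \<in> weighted_kernel K (coxeter_weight vs \<mu>)"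
    unfolding weighted_kernel_def using assms(2) by (auto) (metis UNIV_I split_list)
  finally show ?thesis .
qed

text \<open>Reflections are injective, so the eigenvalues of their products are nonzero.\<close>

lemma reflection_product_eq_0:
  assumes diag: "\<And>v. K $ v $ v = 2" and "reflection_product K vs z = 0"
  shows "z = 0"
  using assms(2)
proof (induction vs)
  case Nil
  then show ?case by simp
next
  case (Cons v vs)
  let ?y = "reflection_product K vs z"
  have "simple_reflection K v ?y = 0"
    using Cons.prems by simp
  then have zero: "simple_reflection K v ?y $ u = 0" for u
    by simp
  have other: "?y $ u = 0" if "u \<noteq> v" for u
    using zero[of u] that by (simp add: simple_reflection_nth)
  have "(\<Sum>w\<in>UNIV. of_int (K $ v $ w) * ?y $ w) = 2 * ?y $ v"
    using other diag by (subst sum.remove[of UNIV v]) auto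
  then have "?y $ v = 0"
    using zero[of v] by (simp add: simple_reflection_nth)
  then have "?y = 0"
    using other by (metis vec_eq_iff zero_index)
  then show ?case
    by (rule Cons.IH)
qed

section \<open>Cocycles on graphs without cycles\<close>

text \<open>
  The first vertex of a longest path has all its neighbours on the path, and a neighbour other than
  the second vertex would close a cycle.
\<close>

lemma acyclic_obtains_leaf:
  assumes "finite S" "S \<noteq> {}"
    and sym: "\<And>v w. E v w \<Longrightarrow> E w v" and irrefl: "\<And>v. \<not> E v v"
    and acyclic: "\<nexists>xs. graph_cycle E xs"
  obtains v u where "v \<in> S" "\<And>w. w \<in> S \<Longrightarrow> E v w \<Longrightarrow> w = u"
proof -
  define path where
    "path xs \<longleftrightarrow> xs \<noteq> [] \<and> set xs \<subseteq> S \<and> distinct xs \<and> successively E xs" for xs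
  obtain s where "s \<in> S"
    using assms(2) by blast
  then have "path [s]"
    by (simp add: path_def)
  moreover have "length xs < Suc (card S)" if "path xs" for xs
    using that card_mono[OF assms(1), of "set xs"] by (auto simp: path_def distinct_card)
  ultimately obtain xs where xs: "path xs" and longest: "\<And>ys. path ys \<Longrightarrow> length ys \<le> length xs"
    using ex_has_greatest_nat[of path "[s]" length "Suc (card S)"] by auto
  obtain v ys where v: "xs = v # ys"
    using xs by (cases xs) (auto simp: path_def)
  have "w = hd ys" if w: "w \<in> S" "E v w" for w
  proof -
    have "w \<in> set xs"
    proof (rule ccontr)
      assume "w \<notin> set xs"
      then have "path (w # xs)"
        using xs w sym unfolding path_def v by auto
      then show False
        using longest by fastforce
    qed
    then have "w \<in> set ys"
      using w irrefl v by auto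
    then obtain as bs where ys: "ys = as @ w # bs"
      by (metis split_list)
    have "as = []"
    proof (rule ccontr)
      assume "as \<noteq> []"
      then have "graph_cycle E (v # as @ [w])"
        using xs sym w unfolding graph_cycle_def path_def v ys
        by (auto simp: successively_append_iff successively_Cons neq_Nil_conv)
      then show False
        using acyclic by blast
    qed
    then show ?thesis
      using ys by simp
  qed
  then show thesis
    using that[of v "hd ys"] xs v by (auto simp: path_def)
qed

text \<open>
  Remove a leaf, trivialise the cocycle on the rest, and choose the value at the leaf to fit the
  only edge that it lies on.
\<close>

lemma acyclic_cocycle_trivial:
  fixes d :: "'a \<Rightarrow> 'a \<Rightarrow> 'k::field"
  assumes "finite S"
    and sym: "\<And>v w. E v w \<Longrightarrow> E w v" and irrefl: "\<And>v. \<not> E v v"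
    and acyclic: "\<nexists>xs. graph_cycle E xs"
    and cocycle: "\<And>v w. E v w \<Longrightarrow> d v w * d w v = 1"
  obtains h where "\<And>v. h v \<noteq> 0" "\<And>v w. v \<in> S \<Longrightarrow> w \<in> S \<Longrightarrow> E v w \<Longrightarrow> h v = d v w * h w"
proof -
  have "\<exists>h. (\<forall>v. h v \<noteq> 0) \<and> (\<forall>v\<in>S. \<forall>w\<in>S. E v w \<longrightarrow> h v = d v w * h w)"
    using assms(1)
  proof (induction S rule: finite_psubset_induct)
    case (psubset S)
    show ?case
    proof (cases "S = {}")
      case True
      then show ?thesis by (auto intro: exI[of _ "\<lambda>_. 1"])
    next
      case False
      then obtain v u where v: "v \<in> S" and leaf: "\<And>w. w \<in> S \<Longrightarrow> E v w \<Longrightarrow> w = u"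
        using acyclic_obtains_leaf[of S E] psubset.hyps sym irrefl acyclic by metis
      obtain h where h: "\<And>w. h w \<noteq> 0"
          "\<And>x y. x \<in> S - {v} \<Longrightarrow> y \<in> S - {v} \<Longrightarrow> E x y \<Longrightarrow> h x = d x y * h y"
        using psubset.IH[of "S - {v}"] v by blast
      define g where "g = h (v := if E v u then d v u * h u else 1)"
      have "g w \<noteq> 0" for w
        using h(1) cocycle[of v u] by (auto simp: g_def)
      moreover have "g x = d x y * g y" if xy: "x \<in> S" "y \<in> S" "E x y" for x y
      proof -
        consider "x = v" "y \<noteq> v" | "y = v" "x \<noteq> v" | "x \<noteq> v" "y \<noteq> v"
          using xy irrefl by blast
        then show ?thesis
        proof cases
          case 1
          then show ?thesis
            using leaf[of y] xy by (auto simp: g_def)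
        next
          case 2
          then have "x = u" "E v u"
            using leaf[of x] xy sym by auto
          then show ?thesis
            using 2 cocycle[of u v] xy by (simp add: g_def mult.assoc[symmetric])
        next
          case 3
          then show ?thesis
            using h(2) xy by (simp add: g_def)
        qed
      qed
      ultimately show ?thesis by blast
    qed
  qed
  then show thesis
    using that by blast
qed

text \<open>
  The ratio of two weightings is a cocycle; if \<open>h\<close> trivialises it, \<open>x \<mapsto> (h\<^sub>v x\<^sub>v)\<^sub>v\<close> maps one
  kernel to the other.
\<close>

lemma weighted_kernel_transfer:
  assumes K: "cartan_tree K"
    and x: "x \<in> weighted_kernel K c" "x \<noteq> 0"
    and diag: "\<And>v. c v v = c' v v"
    and c: "\<And>v w. v \<noteq> w \<Longrightarrow> c v w * c w v = \<mu>"
    and c': "\<And>v w. v \<noteq> w \<Longrightarrow> c' v w * c' w v = \<mu>"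
    and \<mu>: "\<mu> \<noteq> 0"
  obtains y where "y \<in> weighted_kernel K c'" "y \<noteq> 0"
proof -
  have sym: "edge K v w \<Longrightarrow> edge K w v" for v w
    using K by (auto simp: cartan_tree_def cartan_matrix_def edge_def)
  have irrefl: "\<not> edge K v v" for v
    by (simp add: edge_def)
  have acyclic: "\<nexists>xs. graph_cycle (edge K) xs"
    using K by (simp add: cartan_tree_def)
  define d where "d v w = c' v w / c v w" for v w
  have "d v w * d w v = 1" if "edge K v w" for v w
    using c[of v w] c'[of v w] \<mu> that by (simp add: d_def edge_def)
  then obtain h where h: "\<And>v. h v \<noteq> 0" "\<And>v w. edge K v w \<Longrightarrow> h v = d v w * h w"
    using acyclic_cocycle_trivial[of UNIV "edge K" d] sym irrefl acyclic by (metis UNIV_I finite)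
  define y where "y = (\<chi> v. h v * x $ v)"
  have "c' v w * of_int (K $ v $ w) * y $ w = h v * (c v w * of_int (K $ v $ w) * x $ w)" for v w
  proof (cases "edge K v w")
    case True
    then have "c v w \<noteq> 0"
      using c[of v w] \<mu> by (auto simp: edge_def)
    then have "h v * c v w = c' v w * h w"
      using h(2)[OF True] by (simp add: d_def)
    then show ?thesis
      by (simp add: y_def algebra_simps)
  next
    case False
    then show ?thesis
      by (auto simp: edge_def y_def diag)
  qed
  then have "(\<Sum>w\<in>UNIV. c' v w * of_int (K $ v $ w) * y $ w) =
      h v * (\<Sum>w\<in>UNIV. c v w * of_int (K $ v $ w) * x $ w)" for v
    by (simp only: sum_distrib_left)
  then have "y \<in> weighted_kernel K c'"
    using x(1) by (simp add: weighted_kernel_def)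
  moreover have "y \<noteq> 0"
    using x(2) h(1) by (auto simp: y_def vec_eq_iff)
  ultimately show thesis
    using that by blast
qed

text \<open>
  The weighting \<open>c\<close> is arbitrary, so that it may be the one induced by an order of the vertices of
  a larger tree. For \<open>c = coxeter_weight vs \<mu>\<close> this says that the eigenvalues do not depend on
  the order of the reflections.
\<close>

lemma cartan_tree_eigenvalue:
  assumes "cartan_tree K" "C \<in> coxeter_transformations K" "eigenvalue_of C \<mu>"
  shows eigenvalue_nonzero: "\<mu> \<noteq> 0"
    and eigenvalue_weighted_kernel:
      "(\<And>v. c v v = (\<mu> + 1) / 2) \<Longrightarrow> (\<And>v w. v \<noteq> w \<Longrightarrow> c v w * c w v = \<mu>) \<Longrightarrow>
        \<exists>x. x \<in> weighted_kernel K c \<and> x \<noteq> 0"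
proof -
  have diag: "K $ v $ v = 2" for v
    using assms(1) by (simp add: cartan_tree_def cartan_matrix_def)
  obtain vs where vs: "distinct vs" "set vs = UNIV" "C = reflection_product K vs"
    using assms(2) by (auto simp: coxeter_transformations_eq)
  obtain z where z: "z \<noteq> 0" "C z = \<mu> *s z"
    using assms(3) by (auto simp: eigenvalue_of_def)
  show \<mu>: "\<mu> \<noteq> 0"
    using reflection_product_eq_0[OF diag] z vs(3) by fastforce
  have "z \<in> weighted_kernel K (coxeter_weight vs \<mu>)"
    using eigenvector_iff_weighted_kernel[where K = K, OF vs(1,2) diag] z(2) vs(3) by blast
  moreover have "coxeter_weight vs \<mu> v v = (\<mu> + 1) / 2" for v
    by (simp add: coxeter_weight_def)
  moreover have "\<And>v w. v \<noteq> w \<Longrightarrow> coxeter_weight vs \<mu> v w * coxeter_weight vs \<mu> w v = \<mu>"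
    using coxeter_weight_mult_swap[OF vs(1,2)] .
  ultimately show "\<exists>x. x \<in> weighted_kernel K c \<and> x \<noteq> 0"
    if "\<And>v. c v v = (\<mu> + 1) / 2" "\<And>v w. v \<noteq> w \<Longrightarrow> c v w * c w v = \<mu>"
    using weighted_kernel_transfer[OF assms(1) _ z(1), of "coxeter_weight vs \<mu>" c \<mu>] that \<mu>
    by (smt (verit, best))
qed

section \<open>Gluing\<close>

lemma sum_UNIV_option_sum:
  fixes f :: "('a::finite + 'b::finite) option \<Rightarrow> 'c::comm_monoid_add"
  shows "sum f UNIV = f None + ((\<Sum>a\<in>UNIV. f (Some (Inl a))) + (\<Sum>b\<in>UNIV. f (Some (Inr b))))"
proof -
  have "sum f UNIV = f None + (\<Sum>s\<in>UNIV. f (Some s))"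
    by (simp add: UNIV_option_conv sum.reindex)
  also have "(\<Sum>s\<in>UNIV. f (Some s)) = (\<Sum>s\<in>UNIV <+> UNIV. f (Some s))"
    by simp
  also have "\<dots> = (\<Sum>a\<in>UNIV. f (Some (Inl a))) + (\<Sum>b\<in>UNIV. f (Some (Inr b)))"
    by (subst sum.Plus) auto
  finally show ?thesis .
qed

text \<open>
  The witness vanishes at the new vertex, so only the equation there couples the two solutions,
  and a suitable linear combination satisfies it.
\<close>

lemma glue_weighted_kernel:
  assumes x: "x \<in> weighted_kernel K1 (\<lambda>v w. c (Some (Inl v)) (Some (Inl w)))" "x \<noteq> 0"
    and y: "y \<in> weighted_kernel K2 (\<lambda>v w. c (Some (Inr v)) (Some (Inr w)))" "y \<noteq> 0"
  obtains z where "z \<in> weighted_kernel (glue K1 p K2 q) c" "z \<noteq> 0"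
proof -
  define s where "s = c None (Some (Inl p)) * x $ p"
  define t where "t = c None (Some (Inr q)) * y $ q"
  obtain a b where ab: "a * s + b * t = 0" "a \<noteq> 0 \<or> b \<noteq> 0"
  proof (cases "s = 0")
    case True
    then show thesis using that[of 1 0] by simp
  next
    case False
    then show thesis using that[of "- t" s] by simp
  qed
  define z where "z = (\<chi> i. case i of None \<Rightarrow> 0 | Some (Inl v) \<Rightarrow> a * x $ v | Some (Inr v) \<Rightarrow> b * y $ v)"
  have "(\<Sum>w\<in>UNIV. c i w * of_int (glue K1 p K2 q $ i $ w) * z $ w) = 0" for i
  proof -
    consider "i = None" | v where "i = Some (Inl v)" | v where "i = Some (Inr v)"
      by (metis not_None_eq sum.exhaust)
    then show ?thesis
    proof cases
      case 1
      have "(\<Sum>w\<in>UNIV. c i w * of_int (glue K1 p K2 q $ i $ w) * z $ w) = - (a * s + b * t)"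
        by (simp add: 1 sum_UNIV_option_sum glue_def z_def s_def t_def if_distrib if_distribR
            sum.delta cong: if_cong)
      then show ?thesis
        using ab(1) by simp
    next
      case (2 v)
      have "(\<Sum>w\<in>UNIV. c i w * of_int (glue K1 p K2 q $ i $ w) * z $ w) =
          a * (\<Sum>w\<in>UNIV. c i (Some (Inl w)) * of_int (K1 $ v $ w) * x $ w)"
        by (simp add: 2 sum_UNIV_option_sum glue_def z_def sum_distrib_left mult_ac)
      then show ?thesis
        using x(1) 2 by (simp add: weighted_kernel_def)
    next
      case (3 v)
      have "(\<Sum>w\<in>UNIV. c i w * of_int (glue K1 p K2 q $ i $ w) * z $ w) =
          b * (\<Sum>w\<in>UNIV. c i (Some (Inr w)) * of_int (K2 $ v $ w) * y $ w)"
        by (simp add: 3 sum_UNIV_option_sum glue_def z_def sum_distrib_left mult_ac)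
      then show ?thesis
        using y(1) 3 by (simp add: weighted_kernel_def)
    qed
  qed
  then have "z \<in> weighted_kernel (glue K1 p K2 q) c"
    by (simp add: weighted_kernel_def)
  moreover have "z \<noteq> 0"
  proof
    assume "z = 0"
    then have "z $ Some (Inl v) = 0" "z $ Some (Inr w) = 0" for v w
      by simp_all
    then have "a * x $ v = 0" "b * y $ w = 0" for v w
      by (simp_all add: z_def)
    then show False
      using ab(2) x(2) y(2) by (auto simp: vec_eq_iff)
  qed
  ultimately show thesis
    using that by blast
qed

theorem proposition1p1:
  fixes K1 :: "int ^ 'a ^ 'a" and K2 :: "int ^ 'b ^ 'b"
    and p :: "'a::finite" and q :: "'b::finite" and \<mu> :: complex
  assumes "cartan_tree K1"
    and "cartan_tree K2"
    and "C1 \<in> coxeter_transformations K1"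
    and "C2 \<in> coxeter_transformations K2"
    and "C \<in> coxeter_transformations (glue K1 p K2 q)"
    and "eigenvalue_of C1 \<mu>"
    and "eigenvalue_of C2 \<mu>"
  shows "eigenvalue_of C \<mu>"
proof -
  let ?K = "glue K1 p K2 q"
  obtain vs where vs: "distinct vs" "set vs = UNIV" "C = reflection_product ?K vs"
    using assms(5) by (auto simp: coxeter_transformations_eq)
  let ?c = "coxeter_weight vs \<mu>"
  have c: "?c v v = (\<mu> + 1) / 2" "v \<noteq> w \<Longrightarrow> ?c v w * ?c w v = \<mu>" for v w
    using coxeter_weight_mult_swap[OF vs(1,2)] by (simp_all add: coxeter_weight_def)
  obtain x where x: "x \<in> weighted_kernel K1 (\<lambda>v w. ?c (Some (Inl v)) (Some (Inl w)))" "x \<noteq> 0"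
    using eigenvalue_weighted_kernel[OF assms(1,3,6),
        of "\<lambda>v w. ?c (Some (Inl v)) (Some (Inl w))"] c by auto
  obtain y where y: "y \<in> weighted_kernel K2 (\<lambda>v w. ?c (Some (Inr v)) (Some (Inr w)))" "y \<noteq> 0"
    using eigenvalue_weighted_kernel[OF assms(2,4,7),
        of "\<lambda>v w. ?c (Some (Inr v)) (Some (Inr w))"] c by auto
  obtain z where z: "z \<in> weighted_kernel ?K ?c" "z \<noteq> 0"
    using glue_weighted_kernel[where c = ?c, OF x y] .
  have diag: "?K $ v $ v = 2" for v
  proof -
    consider "v = None" | u where "v = Some (Inl u)" | u where "v = Some (Inr u)"
      by (metis not_None_eq sum.exhaust)
    then show ?thesis
      using assms(1,2) by cases (simp_all add: glue_def cartan_tree_def cartan_matrix_def)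
  qed
  show ?thesis
    using eigenvector_iff_weighted_kernel[where K = ?K, OF vs(1,2) diag] z vs(3)
    by (auto simp: eigenvalue_of_def)
qed

end
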